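(* Let $\phi:\mathbb{R}\to\mathbb{C}$ be Riemann's non-differentiable function \[ \phi(t) = \sum_{k \in \mathbb{Z}} \frac{ e^{-4\pi^2 i k^2 t} - 1 }{-4\pi^2 k^2}, \qquad t \in \mathbb{R}. \] Then the Hausdorff dimension of its image, regarded as a subset of $\mathbb{C}\cong\mathbb{R}^2$, satisfies \[ 1 \leq \dim_{\mathcal{H}}\phi(\mathbb{R}) \leq \frac43. \]
   Context: In the series defining $\phi$, the term with $k=0$ is interpreted as its limit value $\lim_{k\to 0}\frac{e^{-4\pi^2 i k^2 t}-1}{-4\pi^2k^2} = it$. The series converges absolutely and uniformly on compact sets, so $\phi$ is continuous. $\dim_{\mathcal{H}}$ denotes Hausdorff dimension. *)

theory Defs
  imports "HOL-Analysis.Analysis"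
begin

text \<open>Riemann's non-differentiable function. The k = 0 term is its limit value i t.\<close>
definition riemann_term :: "real \<Rightarrow> int \<Rightarrow> complex" where
  "riemann_term t k =
     (if k = 0 then \<i> * complex_of_real t
      else (exp (- 4 * complex_of_real (pi\<^sup>2) * \<i> * of_int (k\<^sup>2) * complex_of_real t) - 1)
           / (- 4 * complex_of_real (pi\<^sup>2) * of_int (k\<^sup>2)))"

definition riemann_phi :: "real \<Rightarrow> complex" where
  "riemann_phi t = (\<Sum>\<^sub>\<infinity>k\<in>(UNIV::int set). riemann_term t k)"

definition hausdorff_pre :: "real \<Rightarrow> real \<Rightarrow> 'a::metric_space set \<Rightarrow> ennreal" where
  "hausdorff_pre s \<delta> A =
     (INF U \<in> {U :: nat \<Rightarrow> 'a set. A \<subseteq> (\<Union>i. U i) \<and>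
                 (\<forall>i. bounded (U i) \<and> diameter (U i) \<le> \<delta>)}.
        (\<Sum>i. ennreal (diameter (U i) powr s)))"

definition hausdorff_measure :: "real \<Rightarrow> 'a::metric_space set \<Rightarrow> ennreal" where
  "hausdorff_measure s A = (SUP \<delta> \<in> {0<..}. hausdorff_pre s \<delta> A)"

definition hausdorff_dim :: "'a::metric_space set \<Rightarrow> ereal" where
  "hausdorff_dim A = Inf {ereal s | s. 0 \<le> s \<and> hausdorff_measure s A = 0}"

end

theory Submission
  imports Defs
begin

text \<open>
  Lower bound: \<open>\<phi>\<close> is continuous and \<open>\<phi>(1/(2\<pi>)) - \<phi>(0) = \<i>/(2\<pi>)\<close>, so the imaginary
  parts of the image fill an interval.

  Upper bound: put \<open>\<psi>(x) = \<phi>(x/(2\<pi>))\<close>. By Parseval, the mean square over a period of the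
  increment \<open>\<psi>(x + h) - \<psi>(x)\<close> is about \<open>\<Sum> min(h\<^sup>2, k^(-4))\<close>, that is \<open>h^(3/2)\<close>, up to an
  arbitrarily small loss in the exponent. Averaging over the origin \<open>\<theta>\<close> of the dyadic grid gives
  one \<open>\<theta>\<close> for which the sum of the squared increments of \<open>\<psi>\<close> over the dyadic intervals of
  length \<open>2^(-m)\<close> is at most a constant times \<open>2^(-\<gamma> m)\<close>, for all \<open>m\<close>, where \<open>\<gamma> < 1/2\<close> is
  arbitrary. Chaining turns increments into oscillations: the images of the \<open>2^n\<close> dyadic intervals
  of level \<open>n\<close> have diameters \<open>d\<^sub>j\<close> with \<open>\<Sum> d\<^sub>j\<^sup>2\<close> of order \<open>2^(-\<gamma> n)\<close>, hence by Hoelder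
  \<open>\<Sum> d\<^sub>j^s\<close> is of order \<open>2^(n (1 - s (1 + \<gamma>) / 2))\<close>. This tends to \<open>0\<close> if
  \<open>s > 2 / (1 + \<gamma>)\<close>, and \<open>2 / (1 + \<gamma>)\<close> is as close to \<open>4/3\<close> as we like.
  No arithmetic of Gauss sums is needed.
\<close>

section \<open>Hausdorff null sets\<close>

text \<open>A supremum of infima vanishes exactly when every scale admits covers of arbitrarily
  small cost. In this form the later arguments only handle covers.\<close>

lemma hausdorff_measure_eq_0_iff:
  "hausdorff_measure s (A :: 'a::metric_space set) = 0 \<longleftrightarrow>
    (\<forall>\<delta>>0. \<forall>\<epsilon>>0. \<exists>U :: nat \<Rightarrow> 'a set. A \<subseteq> (\<Union>i. U i) \<and>
       (\<forall>i. bounded (U i) \<and> diameter (U i) \<le> \<delta>) \<and>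
       (\<Sum>i. ennreal (diameter (U i) powr s)) \<le> ennreal \<epsilon>)" (is "?L \<longleftrightarrow> ?R")
proof
  assume L: ?L
  show ?R
  proof (intro allI impI)
    fix \<delta> \<epsilon> :: real assume "\<delta> > 0" "\<epsilon> > 0"
    have "hausdorff_pre s \<delta> A \<le> hausdorff_measure s A"
      unfolding hausdorff_measure_def using \<open>\<delta> > 0\<close> by (intro SUP_upper) auto
    with L have "hausdorff_pre s \<delta> A < ennreal \<epsilon>" using \<open>\<epsilon> > 0\<close> by simp
    then obtain U where "U \<in> {U :: nat \<Rightarrow> 'a set. A \<subseteq> (\<Union>i. U i) \<and>
        (\<forall>i. bounded (U i) \<and> diameter (U i) \<le> \<delta>)}"
      "(\<Sum>i. ennreal (diameter (U i) powr s)) < ennreal \<epsilon>"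
      unfolding hausdorff_pre_def INF_less_iff by blast
    then show "\<exists>U :: nat \<Rightarrow> 'a set. A \<subseteq> (\<Union>i. U i) \<and>
       (\<forall>i. bounded (U i) \<and> diameter (U i) \<le> \<delta>) \<and>
       (\<Sum>i. ennreal (diameter (U i) powr s)) \<le> ennreal \<epsilon>"
      by (intro exI[of _ U]) simp
  qed
next
  assume R: ?R
  have "hausdorff_pre s \<delta> A \<le> 0" if "\<delta> > 0" for \<delta>
  proof (rule ennreal_le_epsilon)
    fix \<epsilon> :: real assume "0 < \<epsilon>"
    with R that obtain U :: "nat \<Rightarrow> 'a set" where U: "A \<subseteq> (\<Union>i. U i)"
       "\<forall>i. bounded (U i) \<and> diameter (U i) \<le> \<delta>"
       "(\<Sum>i. ennreal (diameter (U i) powr s)) \<le> ennreal \<epsilon>" by metis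
    have "hausdorff_pre s \<delta> A \<le> (\<Sum>i. ennreal (diameter (U i) powr s))"
      unfolding hausdorff_pre_def using U(1,2) by (intro INF_lower) auto
    with U(3) show "hausdorff_pre s \<delta> A \<le> 0 + ennreal \<epsilon>" by simp
  qed
  then show ?L unfolding hausdorff_measure_def
    by (metis (no_types, lifting) SUP_least greaterThan_iff le_zero_eq)
qed

text \<open>The \<open>n\<close>-th set gets a cover of cost \<open>\<epsilon> / 2^(n+1)\<close>;
  the double family of covering sets is flattened to a sequence by
  \<open>prod_decode\<close>.\<close>

lemma hausdorff_measure_UN_eq_0:
  fixes A :: "nat \<Rightarrow> 'a::metric_space set"
  assumes "\<And>n. hausdorff_measure s (A n) = 0"
  shows "hausdorff_measure s (\<Union>n. A n) = 0"
  unfolding hausdorff_measure_eq_0_iff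
proof (intro allI impI)
  fix \<delta> \<epsilon> :: real assume pos: "\<delta> > 0" "\<epsilon> > 0"
  have "\<forall>n. \<exists>U :: nat \<Rightarrow> 'a set. A n \<subseteq> (\<Union>i. U i) \<and>
       (\<forall>i. bounded (U i) \<and> diameter (U i) \<le> \<delta>) \<and>
       (\<Sum>i. ennreal (diameter (U i) powr s)) \<le> ennreal (\<epsilon> * (1/2)^Suc n)"
  proof
    fix n
    show "\<exists>U :: nat \<Rightarrow> 'a set. A n \<subseteq> (\<Union>i. U i) \<and>
       (\<forall>i. bounded (U i) \<and> diameter (U i) \<le> \<delta>) \<and>
       (\<Sum>i. ennreal (diameter (U i) powr s)) \<le> ennreal (\<epsilon> * (1/2)^Suc n)"
      using assms[of n, unfolded hausdorff_measure_eq_0_iff] pos by simp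
  qed
  then obtain U :: "nat \<Rightarrow> nat \<Rightarrow> 'a set" where U: "\<And>n. A n \<subseteq> (\<Union>i. U n i)"
       "\<And>n i. bounded (U n i) \<and> diameter (U n i) \<le> \<delta>"
       "\<And>n. (\<Sum>i. ennreal (diameter (U n i) powr s)) \<le> ennreal (\<epsilon> * (1/2)^Suc n)"
    by metis
  define V where "V = (\<lambda>k. case prod_decode k of (n, i) \<Rightarrow> U n i)"
  have V: "V (prod_encode (n, i)) = U n i" for n i by (simp add: V_def)
  have "(\<Union>n. A n) \<subseteq> (\<Union>k. V k)"
  proof
    fix x assume "x \<in> (\<Union>n. A n)"
    then obtain n i where "x \<in> U n i" using U(1) by blast
    then show "x \<in> (\<Union>k. V k)" using V by blast
  qed
  moreover have "\<forall>k. bounded (V k) \<and> diameter (V k) \<le> \<delta>"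
    using U(2) by (simp add: V_def split: prod.split)
  moreover have "(\<Sum>k. ennreal (diameter (V k) powr s)) \<le> ennreal \<epsilon>"
  proof -
    have "(\<Sum>k. ennreal (diameter (V k) powr s)) =
        (\<Sum>k. (\<lambda>(n, i). ennreal (diameter (U n i) powr s)) (prod_decode k))"
      by (simp add: V_def split_beta)
    also have "\<dots> = (\<Sum>n. \<Sum>i. ennreal (diameter (U n i) powr s))"
      by (subst suminf_ennreal_2dimen[where g = "\<lambda>n. (\<Sum>i. ennreal (diameter (U n i) powr s))"])
         (auto simp: comp_def)
    also have "\<dots> \<le> (\<Sum>n. ennreal (\<epsilon> * (1/2)^Suc n))"
      by (intro suminf_le U(3)) auto
    also have "\<dots> = ennreal \<epsilon>"
      using sums_mult[OF power_half_series, of \<epsilon>] pos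
      by (intro suminf_ennreal_eq) auto
    finally show ?thesis .
  qed
  ultimately show "\<exists>V :: nat \<Rightarrow> 'a set. (\<Union>n. A n) \<subseteq> (\<Union>i. V i) \<and>
       (\<forall>i. bounded (V i) \<and> diameter (V i) \<le> \<delta>) \<and>
       (\<Sum>i. ennreal (diameter (V i) powr s)) \<le> ennreal \<epsilon>"
    by blast
qed

section \<open>A lower bound by projection to a line\<close>

text \<open>Projecting a cover by \<open>Im\<close> does not increase diameters, so it gives
  intervals that cover \<open>{0..L}\<close>; Lebesgue measure then bounds the sum of the diameters
  from below.\<close>

lemma hausdorff_measure_pos_of_Im_image:
  fixes A :: "complex set"
  assumes "L > 0" "{0..L} \<subseteq> Im ` A" "s < 1"
  shows "hausdorff_measure s A \<noteq> 0"
proof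
  assume "hausdorff_measure s A = 0"
  \<comment> \<open>Scale 1 gives \<open>d \<le> d powr s\<close> for \<open>s < 1\<close>. The
    budget \<open>L / 3\<close> leaves room for the factor 2 lost below.\<close>
  then obtain U :: "nat \<Rightarrow> complex set" where U: "A \<subseteq> (\<Union>i. U i)"
       "\<And>i. bounded (U i)" "\<And>i. diameter (U i) \<le> 1"
       "(\<Sum>i. ennreal (diameter (U i) powr s)) \<le> ennreal (L / 3)"
    unfolding hausdorff_measure_eq_0_iff
    using \<open>L > 0\<close> by (metis divide_pos_pos zero_less_numeral zero_less_one)
  define d where "d = (\<lambda>i. diameter (U i))"
  \<comment> \<open>Any point of \<open>U i\<close> can serve as centre when the radius is the full
    diameter; this costs the factor 2. For empty \<open>U i\<close> the centre is arbitrary and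
    harmless.\<close>
  define c where "c = (\<lambda>i. Im (SOME u. u \<in> U i))"
  define I where "I = (\<lambda>i. {c i - d i .. c i + d i})"
  have d0: "d i \<ge> 0" for i unfolding d_def by (rule diameter_ge_0[OF U(2)])
  have "Im ` U i \<subseteq> I i" for i
  proof
    fix y assume "y \<in> Im ` U i"
    then obtain u where u: "u \<in> U i" "y = Im u" by blast
    then have "(SOME u. u \<in> U i) \<in> U i" by (metis someI)
    then have "dist u (SOME u. u \<in> U i) \<le> d i"
      unfolding d_def using diameter_bounded_bound[OF U(2)] u by blast
    then have "\<bar>Im (u - (SOME u. u \<in> U i))\<bar> \<le> d i"
      using abs_Im_le_cmod order_trans unfolding dist_norm by blast
    then show "y \<in> I i" using u by (auto simp: I_def c_def)
  qed
  then have "(\<Union>i. Im ` U i) \<subseteq> (\<Union>i. I i)" by (intro UN_mono) auto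
  moreover have "{0..L} \<subseteq> (\<Union>i. Im ` U i)"
    using order_trans[OF assms(2) image_mono[OF U(1), of Im]] by (simp add: image_UN)
  ultimately have "{0..L} \<subseteq> (\<Union>i. I i)" by (rule order_trans[rotated])
  then have "emeasure lborel {0..L} \<le> emeasure lborel (\<Union>i. I i)"
    by (intro emeasure_mono) (auto simp: I_def)
  also have "\<dots> \<le> (\<Sum>i. emeasure lborel (I i))"
    by (intro emeasure_subadditive_countably) (auto simp: I_def)
  also have "\<dots> = (\<Sum>i. 2 * ennreal (d i))"
    using d0 by (intro suminf_cong) (simp add: I_def ennreal_mult' flip: ennreal_numeral)
  also have "\<dots> \<le> (\<Sum>i. 2 * ennreal (d i powr s))"
  proof (intro suminf_le mult_left_mono ennreal_leI)
    show "d i \<le> d i powr s" for i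
      using powr_mono'[of s 1 "d i"] d0[of i] U(3)[of i] \<open>s < 1\<close> unfolding d_def by simp
  qed auto
  also have "\<dots> = 2 * (\<Sum>i. ennreal (d i powr s))" by simp
  also have "\<dots> \<le> 2 * ennreal (L / 3)"
    using U(4) unfolding d_def by (intro mult_left_mono) auto
  finally have "ennreal L \<le> ennreal (2 * (L / 3))"
    using \<open>L > 0\<close> by (subst ennreal_mult) simp_all
  then show False using \<open>L > 0\<close> by simp
qed

text \<open>Bounding pairwise distances by \<open>r\<close> spares the caller any computation of
  diameters; \<open>R\<close> makes the mesh tend to 0 uniformly in \<open>j\<close>.\<close>

lemma hausdorff_measure_eq_0_finite_coverI:
  fixes A :: "'a::metric_space set" and U :: "nat \<Rightarrow> nat \<Rightarrow> 'a set"
  assumes "\<And>n. A \<subseteq> (\<Union>j<N n. U n j)"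
    and "\<And>n j x y. j < N n \<Longrightarrow> x \<in> U n j \<Longrightarrow> y \<in> U n j \<Longrightarrow> dist x y \<le> r n j"
    and "\<And>n j. j < N n \<Longrightarrow> r n j \<ge> 0"
    and "\<And>n j. j < N n \<Longrightarrow> r n j \<le> R n" "R \<longlonglongrightarrow> 0"
    and "(\<lambda>n. \<Sum>j<N n. r n j powr s) \<longlonglongrightarrow> 0" "s \<ge> 0"
  shows "hausdorff_measure s A = 0"
  unfolding hausdorff_measure_eq_0_iff
proof (intro allI impI)
  fix \<delta> \<epsilon> :: real assume pos: "\<delta> > 0" "\<epsilon> > 0"
  have "eventually (\<lambda>n. R n < \<delta> \<and> (\<Sum>j<N n. r n j powr s) < \<epsilon>) sequentially"
    using order_tendstoD(2)[OF assms(5) pos(1)] order_tendstoD(2)[OF assms(6) pos(2)]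
    by eventually_elim auto
  then obtain n where n: "R n < \<delta>" "(\<Sum>j<N n. r n j powr s) < \<epsilon>"
    unfolding eventually_sequentially by blast
  \<comment> \<open>Padding by empty sets is free: their diameter is 0, and
    \<open>0 powr s = 0\<close> even for \<open>s = 0\<close>.\<close>
  define V where "V = (\<lambda>j. if j < N n then U n j else {})"
  have bd: "bounded (V j)" for j
    using assms(2) unfolding V_def bounded_two_points by fastforce
  have dm: "diameter (V j) \<le> r n j" if "j < N n" for j
    using assms(2,3) that by (auto simp: V_def diameter_def intro!: cSUP_least)
  have "A \<subseteq> (\<Union>j. V j)" using assms(1)[of n] by (fastforce simp: V_def)
  moreover have "\<forall>j. bounded (V j) \<and> diameter (V j) \<le> \<delta>"
  proof (intro allI conjI bd)
    fix j show "diameter (V j) \<le> \<delta>"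
    proof (cases "j < N n")
      case True then show ?thesis using dm[of j] assms(4)[of j n] n by linarith
    next
      case False then show ?thesis using pos by (simp add: V_def diameter_empty)
    qed
  qed
  moreover have "(\<Sum>j. ennreal (diameter (V j) powr s)) \<le> ennreal \<epsilon>"
  proof -
    have "(\<Sum>j. ennreal (diameter (V j) powr s)) = (\<Sum>j<N n. ennreal (diameter (V j) powr s))"
      by (intro suminf_finite) (auto simp: V_def diameter_empty)
    also have "\<dots> \<le> (\<Sum>j<N n. ennreal (r n j powr s))"
      using dm bd \<open>s \<ge> 0\<close> by (intro sum_mono ennreal_leI powr_mono2 diameter_ge_0) auto
    also have "\<dots> = ennreal (\<Sum>j<N n. r n j powr s)" using assms(3) by (simp add: sum_ennreal)
    also have "\<dots> \<le> ennreal \<epsilon>" using n by (intro ennreal_leI) simp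
    finally show ?thesis .
  qed
  ultimately show "\<exists>V :: nat \<Rightarrow> 'a set. A \<subseteq> (\<Union>i. V i) \<and>
       (\<forall>i. bounded (V i) \<and> diameter (V i) \<le> \<delta>) \<and>
       (\<Sum>i. ennreal (diameter (V i) powr s)) \<le> ennreal \<epsilon>" by blast
qed

section \<open>Dyadic chaining\<close>

text \<open>Summed over \<open>x\<close> with the best \<open>l\<close>, this replaces the use of Hoelder's inequality.\<close>
lemma powr_le_quadratic:
  fixes x l s :: real
  assumes "x \<ge> 0" "l > 0" "0 \<le> s" "s \<le> 2"
  shows "x powr s \<le> x\<^sup>2 * l powr (s - 2) + l powr s"
proof (cases "x \<le> l")
  case True
  then have "x powr s \<le> l powr s" using assms by (intro powr_mono2) auto
  then show ?thesis by (simp add: add_increasing)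
next
  case False
  then have "x powr s = x powr 2 * x powr (s - 2)" by (simp flip: powr_add)
  also have "\<dots> = x\<^sup>2 * x powr (s - 2)" using False assms by (simp add: powr_numeral)
  also have "\<dots> \<le> x\<^sup>2 * l powr (s - 2)"
    using False assms by (intro mult_left_mono powr_mono2') auto
  finally show ?thesis by (simp add: add_increasing2)
qed

lemma floor_double_cases:
  fixes x :: real
  assumes "x \<ge> 0"
  shows "nat \<lfloor>2 * x\<rfloor> = 2 * nat \<lfloor>x\<rfloor> \<or> nat \<lfloor>2 * x\<rfloor> = 2 * nat \<lfloor>x\<rfloor> + 1"
proof -
  have "\<lfloor>2 * x\<rfloor> = 2 * \<lfloor>x\<rfloor> \<or> \<lfloor>2 * x\<rfloor> = 2 * \<lfloor>x\<rfloor> + 1" by linarith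
  moreover have "\<lfloor>x\<rfloor> \<ge> 0" using assms by simp
  ultimately show ?thesis by linarith
qed

lemma dyadic_floor_tendsto:
  fixes x :: real
  assumes "x \<ge> 0"
  shows "(\<lambda>m. real (nat \<lfloor>2^m * x\<rfloor>) / 2^m) \<longlonglongrightarrow> x"
proof (rule tendsto_sandwich)
  have e: "real (nat \<lfloor>2^m * x\<rfloor>) = of_int \<lfloor>2^m * x\<rfloor>" for m using assms by simp
  show "\<forall>\<^sub>F m in sequentially. x - (1/2)^m \<le> real (nat \<lfloor>2^m * x\<rfloor>) / 2^m"
  proof (intro always_eventually allI)
    fix m
    have "(2^m * x - 1) / 2^m \<le> of_int \<lfloor>2^m * x\<rfloor> / 2^m"
      by (intro divide_right_mono) (linarith, simp)
    then show "x - (1/2)^m \<le> real (nat \<lfloor>2^m * x\<rfloor>) / 2^m"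
      unfolding e by (simp add: diff_divide_distrib power_divide)
  qed
  show "\<forall>\<^sub>F m in sequentially. real (nat \<lfloor>2^m * x\<rfloor>) / 2^m \<le> x"
  proof (intro always_eventually allI)
    fix m
    have "of_int \<lfloor>2^m * x\<rfloor> \<le> 2^m * x" by linarith
    then show "real (nat \<lfloor>2^m * x\<rfloor>) / 2^m \<le> x"
      unfolding e by (simp add: field_simps)
  qed
  show "(\<lambda>m. x - (1/2)^m) \<longlonglongrightarrow> x"
    using tendsto_diff[OF tendsto_const[of x] LIMSEQ_realpow_zero[of "1/2"]] by simp
qed simp

text \<open>Chaining needs no other increment: halving the dyadic interval around a point either
  keeps its left end or moves it to the midpoint.\<close>

definition midpoint_increment :: "(real \<Rightarrow> 'a::metric_space) \<Rightarrow> nat \<Rightarrow> nat \<Rightarrow> real" where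
  "midpoint_increment f m i = dist (f ((2 * real i + 1) / 2^Suc m)) (f (real i / 2^m))"

text \<open>The left ends of the dyadic intervals around \<open>x\<close> converge to
  \<open>x\<close>. Their successive increments are dominated by a geometric series of ratio
  \<open>2 powr (-\<gamma>)\<close>, and continuity at \<open>x\<close> carries the bound to the
  limit.\<close>

lemma dyadic_chaining:
  fixes f :: "real \<Rightarrow> 'a::metric_space" and \<gamma> :: real
  assumes "isCont f x" "x \<ge> 0" "0 < \<gamma>" "0 \<le> a"
    and "\<And>m. m \<ge> n \<Longrightarrow> midpoint_increment f m (nat \<lfloor>2^m * x\<rfloor>) \<le> a * 2 powr (- \<gamma> * real m)"
  shows "dist (f x) (f (real (nat \<lfloor>2^n * x\<rfloor>) / 2^n)) \<le> a * 2 powr (- \<gamma> * real n) / (1 - 2 powr (-\<gamma>))"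
proof -
  define p where "p = (\<lambda>m. real (nat \<lfloor>2^m * x\<rfloor>) / 2^m)"
  define q where "q = 2 powr (-\<gamma>)"
  have q: "0 < q" "q < 1" using \<open>0 < \<gamma>\<close> by (auto simp: q_def powr_less_one)
  have qm: "2 powr (- \<gamma> * real m) = q ^ m" for m
    by (simp add: q_def powr_realpow[symmetric] powr_powr)
  have step: "dist (f (p (Suc m))) (f (p m)) \<le> a * q ^ m" if "m \<ge> n" for m
  proof -
    have "nat \<lfloor>2^Suc m * x\<rfloor> = 2 * nat \<lfloor>2^m * x\<rfloor> \<or> nat \<lfloor>2^Suc m * x\<rfloor> = 2 * nat \<lfloor>2^m * x\<rfloor> + 1"
      using floor_double_cases[of "2^m * x"] \<open>x \<ge> 0\<close> by (simp add: mult.assoc)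
    then have "p (Suc m) = p m \<or> p (Suc m) = (2 * real (nat \<lfloor>2^m * x\<rfloor>) + 1) / 2^Suc m"
      unfolding p_def by (auto simp del: of_nat_nat)
    then have "dist (f (p (Suc m))) (f (p m)) \<le> midpoint_increment f m (nat \<lfloor>2^m * x\<rfloor>)"
      by (auto simp: midpoint_increment_def p_def simp del: of_nat_nat)
    with assms(5)[OF that, unfolded qm] show ?thesis by linarith
  qed
  have part: "dist (f (p (n + k))) (f (p n)) \<le> (\<Sum>l<k. a * q ^ (n + l))" for k
  proof (induction k)
    case (Suc k)
    have "dist (f (p (n + Suc k))) (f (p n)) \<le>
        dist (f (p (Suc (n + k)))) (f (p (n + k))) + dist (f (p (n + k))) (f (p n))"
      by (simp add: dist_triangle)
    with Suc step[of "n + k"] show ?case by simp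
  qed simp
  have "(\<Sum>l<k. a * q ^ (n + l)) \<le> a * q ^ n / (1 - q)" for k
  proof -
    have "(\<Sum>l<k. a * q ^ (n + l)) = a * q ^ n * (\<Sum>l<k. q ^ l)"
      by (simp add: power_add sum_distrib_left mult_ac)
    also have "\<dots> \<le> a * q ^ n * (1 / (1 - q))"
      using q \<open>0 \<le> a\<close> by (intro mult_left_mono) (auto simp: sum_gp_strict divide_right_mono)
    finally show ?thesis by simp
  qed
  then have bd: "dist (f (p (n + k))) (f (p n)) \<le> a * q ^ n / (1 - q)" for k
    using part order_trans by blast
  have "(\<lambda>k. p (k + n)) \<longlonglongrightarrow> x"
    using LIMSEQ_ignore_initial_segment[OF dyadic_floor_tendsto[OF \<open>x \<ge> 0\<close>]] by (simp add: p_def)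
  then have "(\<lambda>k. dist (f (p (k + n))) (f (p n))) \<longlonglongrightarrow> dist (f x) (f (p n))"
    by (intro tendsto_dist isCont_tendsto_compose[OF assms(1)] tendsto_const)
  then have "dist (f x) (f (p n)) \<le> a * q ^ n / (1 - q)"
    by (rule LIMSEQ_le_const2) (use bd in \<open>auto simp: add.commute\<close>)
  then show ?thesis unfolding p_def qm by (simp add: q_def)
qed


text \<open>The weighted energy of all levels below a dyadic interval controls every increment in
  it, and so, by chaining, the size of its image. At each level \<open>n\<close> these local
  energies add up to at most the total energy, which bounds the sum of the squared sizes.\<close>

lemma hausdorff_measure_eq_0_of_dyadic_energy:
  fixes f :: "real \<Rightarrow> 'a::metric_space" and \<gamma> :: real
  assumes cont: "\<And>x. x \<in> {0..<1} \<Longrightarrow> isCont f x" and \<gamma>: "0 < \<gamma>"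
    and energy: "summable (\<lambda>m. 2 powr (\<gamma> * real m) * (\<Sum>i<2^m. (midpoint_increment f m i)\<^sup>2))"
    and s: "0 \<le> s" "s \<le> 2" "2 < s * (1 + \<gamma>)"
  shows "hausdorff_measure s (f ` {0..<1}) = 0"
proof -
  define e where "e = (\<lambda>m i. 2 powr (\<gamma> * real m) * (midpoint_increment f m i)\<^sup>2)"
  define E where "E = (\<lambda>m. \<Sum>i<2^m. e m i)"
  \<comment> \<open>Energy of level \<open>m\<close> inside interval \<open>j\<close> of level
    \<open>n\<close>. The case \<open>m < n\<close> is set to 0 explicitly, since the truncated
    \<open>m - n\<close> would pick up an unrelated index.\<close>
  define B where "B = (\<lambda>n j m. if m < n then 0 else
    (\<Sum>i\<in>{j * 2^(m - n)..<j * 2^(m - n) + 2^(m - n)}. e m i))"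
  define A where "A = (\<lambda>n j. \<Sum>m. B n j m)"
  define W where "W = (\<Sum>m. E m)"
  define C where "C = 1 / (1 - 2 powr (- (\<gamma> / 2)))"
  \<comment> \<open>The rate is \<open>\<gamma> / 2\<close> because increments are square roots of
    energies. The factor 2 comes from comparing two points through the left end of the
    interval.\<close>
  define r where "r = (\<lambda>n j. 2 * (sqrt (A n j) * 2 powr (- (\<gamma> / 2) * real n) * C))"
  define \<kappa> where "\<kappa> = s * (1 + \<gamma>) / 2 - 1"
  have \<kappa>: "\<kappa> > 0" using s by (simp add: \<kappa>_def)
  have C: "C > 0" using \<gamma> by (simp add: C_def powr_less_one)
  have e0: "e m i \<ge> 0" for m i by (simp add: e_def)
  have E: "summable E" using energy unfolding E_def e_def by (simp add: sum_distrib_left)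
  have E0: "E m \<ge> 0" for m by (simp add: E_def e0 sum_nonneg)
  have B0: "B n j m \<ge> 0" for n j m by (simp add: B_def e0 sum_nonneg)
  have sumB: "(\<Sum>j<2^n. B n j m) \<le> E m" for n m
  proof (cases "m < n")
    case True then show ?thesis by (simp add: B_def E0)
  next
    case False
    then have "(2::nat)^n * 2^(m - n) = 2^m" by (simp flip: power_add)
    then show ?thesis using False by (simp add: B_def E_def sum.nat_group)
  qed
  have BE: "B n j m \<le> E m" if "j < 2^n" for n j m
  proof -
    have "B n j m \<le> (\<Sum>j<2^n. B n j m)" using that B0 by (intro member_le_sum) auto
    then show ?thesis using sumB order_trans by blast
  qed
  have sB: "summable (B n j)" if "j < 2^n" for n j
    by (rule summable_comparison_test'[OF E, of 0]) (use BE[OF that] B0 in auto)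
  have A0: "A n j \<ge> 0" if "j < 2^n" for n j
    unfolding A_def by (intro suminf_nonneg sB that B0)
  have sumA: "(\<Sum>j<2^n. A n j) \<le> W" for n
  proof -
    have "(\<Sum>j<2^n. A n j) = (\<Sum>m. \<Sum>j<2^n. B n j m)"
      unfolding A_def by (subst suminf_sum) (auto intro: sB)
    also have "\<dots> \<le> W" unfolding W_def
      by (intro suminf_le sumB E summable_sum sB) auto
    finally show ?thesis .
  qed
  have AW: "A n j \<le> W" if "j < 2^n" for n j
  proof -
    have "A n j \<le> (\<Sum>j<2^n. A n j)" using that A0 by (intro member_le_sum) auto
    then show ?thesis using sumA order_trans by blast
  qed
  have W0: "W \<ge> 0" unfolding W_def by (intro suminf_nonneg E E0)
  have near: "dist (f x) (f (real j / 2^n)) \<le> r n j / 2"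
    if j: "j < 2^n" and x: "x \<in> {real j / 2^n..<(real j + 1) / 2^n}" for n j x
  proof -
    have x0: "x \<ge> 0" using x by (meson atLeastLessThan_iff divide_nonneg_nonneg of_nat_0_le_iff order_trans zero_le_numeral zero_le_power)
    have jn: "real j + 1 \<le> 2^n" using j
      by (metis Suc_leI of_nat_Suc of_nat_le_iff of_nat_numeral of_nat_power add.commute)
    have "(real j + 1) / 2^n \<le> 1" using jn by simp
    then have x1: "x < 1" using x by (meson atLeastLessThan_iff less_le_trans)
    \<comment> \<open>The level \<open>m\<close> intervals around \<open>x\<close> all descend from
      interval \<open>j\<close>, so their energies are counted in \<open>A n j\<close>.\<close>
    have fl: "nat \<lfloor>2^m * x\<rfloor> \<in> {j * 2^(m - n)..<j * 2^(m - n) + 2^(m - n)}" if "m \<ge> n" for m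
    proof -
      have two: "(2::real)^m = 2^(m - n) * 2^n" using that by (simp flip: power_add)
      have "real j \<le> 2^n * x" "2^n * x < real j + 1" using x by (auto simp: field_simps)
      then have "2^(m - n) * real j \<le> 2^(m - n) * (2^n * x)"
        "2^(m - n) * (2^n * x) < 2^(m - n) * (real j + 1)" by auto
      then have b: "real (j * 2^(m - n)) \<le> 2^m * x" "2^m * x < real (j * 2^(m - n) + 2^(m - n))"
        by (auto simp: two algebra_simps)
      from b(1) have "j * 2^(m - n) \<le> nat \<lfloor>2^m * x\<rfloor>" using x0 by (simp add: le_nat_floor)
      moreover from b(2) have "\<lfloor>2^m * x\<rfloor> < int (j * 2^(m - n) + 2^(m - n))"
        by (simp only: floor_less_iff of_int_of_nat_eq)
      then have "nat \<lfloor>2^m * x\<rfloor> < j * 2^(m - n) + 2^(m - n)"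
        using x0 by (simp only: nat_less_iff zero_le_floor zero_le_mult_iff zero_le_power zero_le_numeral simp_thms)
      ultimately show ?thesis by simp
    qed
    have inc: "midpoint_increment f m (nat \<lfloor>2^m * x\<rfloor>) \<le> sqrt (A n j) * 2 powr (- (\<gamma> / 2) * real m)"
      if "m \<ge> n" for m
    proof -
      let ?i = "nat \<lfloor>2^m * x\<rfloor>"
      have "e m ?i \<le> B n j m" using that fl[OF that] e0
        by (auto simp: B_def intro!: member_le_sum)
      also have "\<dots> \<le> A n j" unfolding A_def
        using sum_le_suminf[OF sB[OF j], of "{m}"] B0 by simp
      finally have "sqrt (e m ?i) \<le> sqrt (A n j)" by simp
      moreover have "sqrt (e m ?i) = 2 powr (\<gamma> / 2 * real m) * midpoint_increment f m ?i"
        by (simp add: e_def real_sqrt_mult midpoint_increment_def powr_half_sqrt[symmetric] powr_powr)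
      ultimately have "2 powr (\<gamma> / 2 * real m) * midpoint_increment f m ?i \<le> sqrt (A n j)" by simp
      then show ?thesis by (simp add: powr_minus pos_le_divide_eq mult.commute flip: divide_inverse)
    qed
    have "nat \<lfloor>2^n * x\<rfloor> = j" using fl[of n] by auto
    moreover have "dist (f x) (f (real (nat \<lfloor>2^n * x\<rfloor>) / 2^n)) \<le>
        sqrt (A n j) * 2 powr (- (\<gamma> / 2) * real n) / (1 - 2 powr (- (\<gamma> / 2)))"
      using cont[of x] x0 x1 \<gamma> A0[OF j] by (intro dyadic_chaining inc) auto
    moreover have "r n j / 2 = sqrt (A n j) * 2 powr (- (\<gamma> / 2) * real n) * C"
      by (simp add: r_def)
    ultimately show ?thesis by (simp only: C_def times_divide_eq_right mult_1_right)
  qed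
  show ?thesis
  proof (rule hausdorff_measure_eq_0_finite_coverI)
    fix n :: nat
    show "f ` {0..<1} \<subseteq> (\<Union>j<2^n. f ` {real j / 2^n..<(real j + 1) / 2^n})"
    proof
      fix y assume "y \<in> f ` {0..<1}"
      then obtain x where x: "y = f x" "0 \<le> x" "x < 1" by auto
      have "real (nat \<lfloor>2^n * x\<rfloor>) \<le> 2^n * x" using x by auto
      also have "\<dots> < real (2^n)" using x by simp
      finally have "nat \<lfloor>2^n * x\<rfloor> < 2^n" by (simp only: of_nat_less_iff)
      moreover have "real (nat \<lfloor>2^n * x\<rfloor>) \<le> 2^n * x" "2^n * x < real (nat \<lfloor>2^n * x\<rfloor>) + 1"
        using x by auto
      then have "x \<in> {real (nat \<lfloor>2^n * x\<rfloor>) / 2^n..<(real (nat \<lfloor>2^n * x\<rfloor>) + 1) / 2^n}"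
        by (simp add: field_simps del: of_nat_nat)
      ultimately show "y \<in> (\<Union>j<2^n. f ` {real j / 2^n..<(real j + 1) / 2^n})"
        using x(1) by blast
    qed
  next
    fix n j :: nat and y z
    assume j: "j < 2^n" and "y \<in> f ` {real j / 2^n..<(real j + 1) / 2^n}"
      "z \<in> f ` {real j / 2^n..<(real j + 1) / 2^n}"
    then have "dist y (f (real j / 2^n)) \<le> r n j / 2" "dist z (f (real j / 2^n)) \<le> r n j / 2"
      using near[OF j] by blast+
    then show "dist y z \<le> r n j" using dist_triangle2[of y z "f (real j / 2^n)"] by linarith
  next
    fix n j :: nat assume j: "j < 2^n"
    show "r n j \<ge> 0" using C A0[OF j] by (simp add: r_def)
    show "r n j \<le> 2 * (sqrt W * 2 powr (- (\<gamma> / 2) * real n) * C)"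
      unfolding r_def using C AW[OF j] by (intro mult_left_mono mult_right_mono) auto
  next
    have "(\<lambda>n. (2 powr (- (\<gamma> / 2)))^n) \<longlonglongrightarrow> 0"
      using \<gamma> by (intro LIMSEQ_realpow_zero) (auto simp: powr_less_one)
    then have "(\<lambda>n. 2 powr (- (\<gamma> / 2) * real n)) \<longlonglongrightarrow> 0"
      by (simp add: powr_realpow[symmetric] powr_powr)
    from tendsto_mult_left[OF this, of "2 * sqrt W * C"]
    show "(\<lambda>n. 2 * (sqrt W * 2 powr (- (\<gamma> / 2) * real n) * C)) \<longlonglongrightarrow> 0"
      by (simp add: mult_ac)
  next
    have "(\<lambda>n. (2 powr (- \<kappa>))^n) \<longlonglongrightarrow> 0"
      using \<kappa> by (intro LIMSEQ_realpow_zero) (auto simp: powr_less_one)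
    then have "(\<lambda>n. 2 powr (- \<kappa> * real n)) \<longlonglongrightarrow> 0"
      by (simp add: powr_realpow[symmetric] powr_powr)
    from tendsto_mult_left[OF this, of "4 * C\<^sup>2 * W + 1"]
    have lim: "(\<lambda>n. (4 * C\<^sup>2 * W + 1) * 2 powr (- \<kappa> * real n)) \<longlonglongrightarrow> 0" by simp
    have le: "(\<Sum>j<2^n. r n j powr s) \<le> (4 * C\<^sup>2 * W + 1) * 2 powr (- \<kappa> * real n)" for n
    proof -
      \<comment> \<open>This length balances the two terms of the quadratic bound: with
        \<open>l^2 = 2^(-(1 + \<gamma>) n)\<close>, both \<open>2^(-\<gamma> n) l^(s - 2)\<close>
        and \<open>2^n l^s\<close> equal \<open>2^(-\<kappa> n)\<close>.\<close>
      define l where "l = 2 powr (- ((1 + \<gamma>) / 2) * real n)"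
      have "(\<Sum>j<2^n. r n j powr s) \<le> (\<Sum>j<2^n. (r n j)\<^sup>2 * l powr (s - 2) + l powr s)"
        using C A0 s by (intro sum_mono powr_le_quadratic) (auto simp: r_def l_def)
      also have "\<dots> = (\<Sum>j<2^n. (r n j)\<^sup>2) * l powr (s - 2) + 2^n * l powr s"
        by (simp add: sum.distrib sum_distrib_right)
      also have "(\<Sum>j<2^n. (r n j)\<^sup>2) = 4 * C\<^sup>2 * 2 powr (- \<gamma> * real n) * (\<Sum>j<2^n. A n j)"
      proof -
        have "(2 powr (- (\<gamma> / 2) * real n))\<^sup>2 = 2 powr (- \<gamma> * real n)"
          by (simp add: power2_eq_square flip: powr_add)
        then show ?thesis unfolding sum_distrib_left
          using A0 by (intro sum.cong) (auto simp: r_def power_mult_distrib)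
      qed
      also have "\<dots> * l powr (s - 2) + 2^n * l powr s \<le>
          4 * C\<^sup>2 * 2 powr (- \<gamma> * real n) * W * l powr (s - 2) + 2^n * l powr s"
        using sumA by (intro add_right_mono mult_right_mono mult_left_mono) auto
      also have "\<dots> = 4 * C\<^sup>2 * W * (2 powr (- \<gamma> * real n) * l powr (s - 2)) + 2^n * l powr s"
        by (simp add: mult_ac)
      also have "2 powr (- \<gamma> * real n) * l powr (s - 2) = 2 powr (- \<kappa> * real n)"
        unfolding l_def powr_powr powr_add[symmetric] \<kappa>_def
        by (rule arg_cong[where f = "(powr) 2"]) (simp add: field_simps)
      also have "2^n * l powr s = 2 powr (- \<kappa> * real n)"
        unfolding l_def powr_powr powr_realpow[of 2 n, simplified, symmetric] powr_add[symmetric] \<kappa>_def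
        by (rule arg_cong[where f = "(powr) 2"]) (simp add: field_simps)
      finally show ?thesis by (simp add: algebra_simps)
    qed
    show "(\<lambda>n. \<Sum>j<2^n. r n j powr s) \<longlonglongrightarrow> 0"
      by (rule tendsto_sandwich[OF _ _ tendsto_const lim])
        (use le in \<open>auto intro!: always_eventually sum_nonneg\<close>)
  qed (use s in auto)
qed

section \<open>Mean square increments of Riemann's function\<close>

lemma has_integral_cis_int:
  "((\<lambda>x. cis (2 * pi * of_int n * x)) has_integral (if n = 0 then 1 else 0)) {0..1}"
proof (cases "n = 0")
  case True
  then show ?thesis using has_integral_const_real[of "1::complex" 0 1] by (simp add: cis_zero)
next
  case False
  define c where "c = \<i> * complex_of_real (2 * pi * of_int n)"
  have c: "c \<noteq> 0" using False by (simp add: c_def)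
  have e: "cis (2 * pi * of_int n * x) = exp (c * of_real x)" for x
    by (simp add: cis_conv_exp c_def mult_ac)
  have "((\<lambda>x. exp (c * of_real x) / c) has_vector_derivative exp (c * of_real x)) (at x within {0..1})" for x
  proof -
    have "((\<lambda>z. exp (c * z) / c) has_field_derivative exp (c * of_real x)) (at (of_real x))"
      using c by (auto intro!: derivative_eq_intros)
    from has_vector_derivative_real_field[OF this] show ?thesis
      by (rule has_vector_derivative_at_within)
  qed
  then have "((\<lambda>x. exp (c * of_real x)) has_integral
      (exp (c * of_real 1) / c - exp (c * of_real 0) / c)) {0..1}"
    by (intro fundamental_theorem_of_calculus) auto
  moreover have "exp (c * of_real 1) = cis (2 * pi * of_int n)" using e[of 1] by simp
  moreover have "cis (2 * pi * of_int n) = 1" by (rule cis_multiple_2pi) simp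
  ultimately show ?thesis using False by (simp add: e)
qed

text \<open>Expanding the square leaves only the diagonal, because distinct indices have distinct
  frequencies. Finite sums suffice: Fatou's lemma takes the limit later.\<close>

lemma trig_sum_parseval:
  fixes b :: "'i \<Rightarrow> complex" and \<nu> :: "'i \<Rightarrow> int"
  assumes "finite K" "inj_on \<nu> K"
  shows "((\<lambda>x. (cmod (\<Sum>k\<in>K. b k * cis (2 * pi * of_int (\<nu> k) * x)))\<^sup>2)
    has_integral (\<Sum>k\<in>K. (cmod (b k))\<^sup>2)) {0..1}"
proof -
  have eq: "complex_of_real ((cmod (\<Sum>k\<in>K. b k * cis (2 * pi * of_int (\<nu> k) * x)))\<^sup>2) =
      (\<Sum>k\<in>K. \<Sum>l\<in>K. b k * cnj (b l) * cis (2 * pi * of_int (\<nu> k - \<nu> l) * x))" for x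
    by (simp add: complex_norm_square sum_product cis_cnj cis_mult algebra_simps del: of_real_power)
  have "((\<lambda>x. \<Sum>k\<in>K. \<Sum>l\<in>K. b k * cnj (b l) * cis (2 * pi * of_int (\<nu> k - \<nu> l) * x)) has_integral
      (\<Sum>k\<in>K. \<Sum>l\<in>K. b k * cnj (b l) * (if \<nu> k - \<nu> l = 0 then 1 else 0))) {0..1}"
    using assms(1) by (intro has_integral_sum has_integral_mult_right has_integral_cis_int)
  also have "(\<Sum>k\<in>K. \<Sum>l\<in>K. b k * cnj (b l) * (if \<nu> k - \<nu> l = 0 then 1 else 0)) =
      (\<Sum>k\<in>K. \<Sum>l\<in>K. if k = l then b k * cnj (b l) else 0)"
    using assms(2) by (intro sum.cong refl) (auto simp: inj_on_def)
  also have "\<dots> = complex_of_real (\<Sum>k\<in>K. (cmod (b k))\<^sup>2)"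
    using assms(1) by (simp add: complex_norm_square del: of_real_power)
  finally have "((\<lambda>x. complex_of_real ((cmod (\<Sum>k\<in>K. b k * cis (2 * pi * of_int (\<nu> k) * x)))\<^sup>2))
     has_integral complex_of_real (\<Sum>k\<in>K. (cmod (b k))\<^sup>2)) {0..1}"
    unfolding eq .
  from has_integral_linear[OF this bounded_linear_Re] show ?thesis
    by (simp add: o_def)
qed

text \<open>Gathers the terms of index \<open>k\<close> and \<open>- k\<close>, at time \<open>x / (2 \<pi>)\<close>.\<close>
definition riemann_pair :: "nat \<Rightarrow> real \<Rightarrow> complex" where
  "riemann_pair k x = (if k = 0 then \<i> * of_real (x / (2 * pi))
     else (1 - cis (- (2 * pi * real k ^ 2 * x))) / of_real (2 * pi\<^sup>2 * real k ^ 2))"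

section \<open>Convergence, translation and continuity of Riemann's series\<close>

lemma riemann_term_0: "riemann_term (x / (2 * pi)) 0 = riemann_pair 0 x"
  by (simp add: riemann_term_def riemann_pair_def)

lemma riemann_term_pair:
  assumes "k \<noteq> 0"
  shows "2 * riemann_term (x / (2 * pi)) (int k) = riemann_pair k x"
    and "2 * riemann_term (x / (2 * pi)) (- int k) = riemann_pair k x"
proof -
  have "exp (- 4 * complex_of_real (pi\<^sup>2) * \<i> * of_int ((int k)\<^sup>2) * complex_of_real (x / (2 * pi)))
     = cis (- (2 * pi * real k ^ 2 * x))"
    unfolding cis_conv_exp by (rule arg_cong[where f = exp]) (simp add: field_simps power2_eq_square)
  then show *: "2 * riemann_term (x / (2 * pi)) (int k) = riemann_pair k x"
    using assms by (simp add: riemann_term_def riemann_pair_def divide_simps)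
  have "riemann_term (x / (2 * pi)) (- int k) = riemann_term (x / (2 * pi)) (int k)"
    using assms by (simp add: riemann_term_def)
  with * show "2 * riemann_term (x / (2 * pi)) (- int k) = riemann_pair k x" by simp
qed

lemma norm_one_minus_cis_le: "cmod (1 - cis y) \<le> \<bar>y\<bar>"
proof -
  have "cmod (1 - cis y) = 2 * \<bar>sin (y / 2)\<bar>"
    using dist_exp_i_1[of y] by (simp add: cis_conv_exp norm_minus_commute)
  also have "\<dots> \<le> \<bar>y\<bar>" using abs_sin_x_le_abs_x[of "y/2"] by simp
  finally show ?thesis .
qed

text \<open>The chord \<open>1 - cis y\<close> is at most the arc and at most 2. The first bound is
  the better one for \<open>k^2 * \<bar>x\<bar> < 1\<close>, the second for large
  \<open>k\<close>.\<close>

lemma norm_riemann_pair_le: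
  assumes "k \<noteq> 0"
  shows "cmod (riemann_pair k x) \<le> \<bar>x\<bar>" "cmod (riemann_pair k x) \<le> 1 / real k ^ 2"
proof -
  have n: "cmod (riemann_pair k x) = cmod (1 - cis (- (2 * pi * real k ^ 2 * x))) / (2 * pi\<^sup>2 * real k ^ 2)"
    using assms by (simp add: riemann_pair_def norm_divide norm_mult norm_power del: of_real_power)
  have pi1: "pi \<ge> 1" using pi_gt3 by linarith
  have "cmod (riemann_pair k x) \<le> (2 * pi * real k ^ 2 * \<bar>x\<bar>) / (2 * pi\<^sup>2 * real k ^ 2)"
    unfolding n using norm_one_minus_cis_le[of "- (2 * pi * real k ^ 2 * x)"]
    by (intro divide_right_mono) (auto simp: abs_mult)
  also have "\<dots> = \<bar>x\<bar> / pi" using assms by (simp add: power2_eq_square)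
  also have "\<dots> \<le> \<bar>x\<bar>" using pi1 by (simp add: divide_le_eq mult_le_cancel_left1)
  finally show "cmod (riemann_pair k x) \<le> \<bar>x\<bar>" .
  have "cmod (riemann_pair k x) \<le> 2 / (2 * pi\<^sup>2 * real k ^ 2)"
    unfolding n using norm_triangle_ineq4[of 1 "cis (- (2 * pi * real k ^ 2 * x))"]
    by (intro divide_right_mono) auto
  also have "\<dots> = (1 / pi\<^sup>2) * (1 / real k ^ 2)" by simp
  also have "\<dots> \<le> 1 * (1 / real k ^ 2)"
    using pi1 by (intro mult_right_mono) (auto simp: divide_le_eq one_le_power)
  finally show "cmod (riemann_pair k x) \<le> 1 / real k ^ 2" by simp
qed

lemma summable_norm_riemann_pair: "summable (\<lambda>k. cmod (riemann_pair k x))"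
  by (rule summable_comparison_test'[OF inverse_power_summable[of 2], of 1])
     (use norm_riemann_pair_le(2) in \<open>auto simp: inverse_eq_divide\<close>)

lemma riemann_term_summable_on: "riemann_term (x / (2 * pi)) summable_on UNIV"
proof (rule abs_summable_summable)
  let ?t = "\<lambda>k. riemann_term (x / (2 * pi)) k"
  have nat: "(\<lambda>n. norm (?t (int n))) summable_on UNIV" and neg: "(\<lambda>n. norm (?t (- int n))) summable_on UNIV"
  proof -
    have b: "norm (norm (?t (int n))) \<le> cmod (riemann_pair n x)"
      "norm (norm (?t (- int n))) \<le> cmod (riemann_pair n x)" for n
      using riemann_term_pair[of n x, symmetric] riemann_term_0[of x]
      by (cases "n = 0"; simp add: norm_mult)+
    show "(\<lambda>n. norm (?t (int n))) summable_on UNIV" "(\<lambda>n. norm (?t (- int n))) summable_on UNIV"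
      by (rule norm_summable_imp_summable_on,
          rule summable_comparison_test'[OF summable_norm_riemann_pair[of x], of 0], use b in simp)+
  qed
  \<comment> \<open>The two ranges share 0, which does no harm as only summability is at
    stake.\<close>
  have "(\<lambda>k. norm (?t k)) summable_on range int" "(\<lambda>k. norm (?t k)) summable_on range (\<lambda>n. - int n)"
    using nat neg
    by (subst summable_on_reindex; auto simp: inj_def o_def)+
  then have "(\<lambda>k. norm (?t k)) summable_on (range int \<union> range (\<lambda>n. - int n))"
    by (rule summable_on_union)
  moreover have "k \<in> range int \<union> range (\<lambda>n. - int n)" for k
    by (cases k rule: int_cases2) auto
  then have "range int \<union> range (\<lambda>n. - int n) = UNIV" by blast
  ultimately show "(\<lambda>k. norm (?t k)) summable_on UNIV" by simp
qed

text \<open>The unconditional sum over the integers is the limit of its symmetric partial sums,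
  which pair the indices \<open>k\<close> and \<open>- k\<close>.\<close>

lemma riemann_pair_sums: "(\<lambda>k. riemann_pair k x) sums riemann_phi (x / (2 * pi))"
proof -
  let ?t = "\<lambda>k. riemann_term (x / (2 * pi)) k"
  have "(?t has_sum riemann_phi (x / (2 * pi))) UNIV"
    unfolding riemann_phi_def using riemann_term_summable_on by (rule has_sum_infsum)
  then have lim: "(sum ?t \<longlongrightarrow> riemann_phi (x / (2 * pi))) (finite_subsets_at_top UNIV)"
    by (simp add: has_sum_def)
  have "filterlim (\<lambda>N. {- int N..int N}) (finite_subsets_at_top UNIV) sequentially"
    unfolding filterlim_finite_subsets_at_top
  proof (intro allI impI)
    fix X :: "int set" assume "finite X \<and> X \<subseteq> UNIV"
    then obtain M where M: "\<And>k. k \<in> X \<Longrightarrow> nat \<bar>k\<bar> \<le> M"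
      using finite_nat_set_iff_bounded_le[of "(\<lambda>k. nat \<bar>k\<bar>) ` X"] by auto
    have "X \<subseteq> {- int N..int N}" if "N \<ge> M" for N
      using M that by fastforce
    then show "\<forall>\<^sub>F N in sequentially. finite {- int N..int N} \<and> X \<subseteq> {- int N..int N} \<and> {- int N..int N} \<subseteq> UNIV"
      by (auto simp: eventually_sequentially)
  qed
  from filterlim_compose[OF lim this]
  have "(\<lambda>N. \<Sum>k\<in>{- int N..int N}. ?t k) \<longlonglongrightarrow> riemann_phi (x / (2 * pi))" .
  moreover have "(\<Sum>k\<in>{- int N..int N}. ?t k) = (\<Sum>k\<le>N. riemann_pair k x)" for N
  proof (induction N)
    case 0 then show ?case by (simp add: riemann_term_0)
  next
    case (Suc N)
    have "{- int (Suc N)..int (Suc N)} = insert (int (Suc N)) (insert (- int (Suc N)) {- int N..int N})"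
      by auto
    then have "(\<Sum>k\<in>{- int (Suc N)..int (Suc N)}. ?t k) =
        ?t (int (Suc N)) + (?t (- int (Suc N)) + (\<Sum>k\<in>{- int N..int N}. ?t k))"
      by (simp del: of_nat_Suc)
    with Suc riemann_term_pair[of "Suc N" x] show ?case
      by (simp del: of_nat_Suc) (metis add.assoc add.commute mult_2 mult_cancel_left zero_neq_numeral)
  qed
  ultimately show ?thesis by (simp add: sums_def_le)
qed


text \<open>In the rescaled time every term with \<open>k \<noteq> 0\<close> has period 1, so only
  the linear term \<open>k = 0\<close> moves. The images of successive unit intervals are therefore
  translates of each other.\<close>

lemma riemann_phi_plus_int:
  "riemann_phi ((x + of_int n) / (2 * pi)) = riemann_phi (x / (2 * pi)) + \<i> * of_real (of_int n / (2 * pi))"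
proof -
  have eq: "riemann_pair k (x + of_int n) - riemann_pair k x = (if k = 0 then \<i> * of_real (of_int n / (2 * pi)) else 0)" for k
  proof (cases "k = 0")
    case True then show ?thesis by (simp add: riemann_pair_def add_divide_distrib algebra_simps)
  next
    case False
    have "- (2 * pi * real k ^ 2 * (x + of_int n)) =
        - (2 * pi * real k ^ 2 * x) + 2 * pi * of_int (- (int k ^ 2 * n))" by (simp add: algebra_simps)
    moreover have "cis (2 * pi * of_int (- (int k ^ 2 * n))) = 1" by (rule cis_multiple_2pi) simp
    ultimately have "cis (- (2 * pi * real k ^ 2 * (x + of_int n))) = cis (- (2 * pi * real k ^ 2 * x))"
      by (simp only: cis_mult[symmetric] mult_1_right)
    then show ?thesis using False by (simp add: riemann_pair_def)
  qed
  have "(\<lambda>k. riemann_pair k (x + of_int n) - riemann_pair k x) sums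
      (riemann_phi ((x + of_int n) / (2 * pi)) - riemann_phi (x / (2 * pi)))"
    by (intro sums_diff riemann_pair_sums)
  then have "(\<lambda>k. if k = 0 then \<i> * of_real (of_int n / (2 * pi)) else 0) sums
      (riemann_phi ((x + of_int n) / (2 * pi)) - riemann_phi (x / (2 * pi)))" unfolding eq .
  moreover have "(\<lambda>k::nat. if k = 0 then \<i> * of_real (of_int n / (2 * pi)) else 0) sums (\<i> * complex_of_real (of_int n / (2 * pi)))"
    by (rule sums_single)
  ultimately show ?thesis using sums_unique2 by (metis add.commute diff_eq_eq)
qed

text \<open>The term \<open>k = 0\<close> is unbounded in \<open>x\<close> and is split off; the
  others are dominated by \<open>1 / k^2\<close>, uniformly in \<open>x\<close>.\<close>

lemma continuous_on_riemann_phi: "continuous_on UNIV (\<lambda>x. riemann_phi (x / (2 * pi)))"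
proof -
  have cp: "continuous_on UNIV (riemann_pair k)" for k
    unfolding riemann_pair_def by (cases "k = 0") (auto intro!: continuous_intros)
  have "uniform_limit UNIV (\<lambda>n x. \<Sum>k<n. riemann_pair (Suc k) x) (\<lambda>x. \<Sum>k. riemann_pair (Suc k) x) sequentially"
  proof (rule Weierstrass_m_test)
    show "summable (\<lambda>k. 1 / real (Suc k) ^ 2)"
      using inverse_power_summable[of 2, where ?'a = real] summable_Suc_iff[of "\<lambda>k. 1 / real k ^ 2"]
      by (simp add: inverse_eq_divide)
  qed (use norm_riemann_pair_le(2) in blast)
  then have "continuous_on UNIV (\<lambda>x. \<Sum>k. riemann_pair (Suc k) x)"
    by (rule uniform_limit_theorem[rotated]) (auto intro!: always_eventually continuous_on_sum cp)
  then have "continuous_on UNIV (\<lambda>x. (\<Sum>k. riemann_pair (Suc k) x) + riemann_pair 0 x)"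
    by (intro continuous_on_add cp)
  moreover have "riemann_phi (x / (2 * pi)) = (\<Sum>k. riemann_pair (Suc k) x) + riemann_pair 0 x" for x
    using suminf_split_head[OF sums_summable[OF riemann_pair_sums[of x]]] sums_unique[OF riemann_pair_sums[of x]]
    by simp
  ultimately show ?thesis by simp
qed

section \<open>Mean square of the increments\<close>

text \<open>Written as a coefficient times a character in \<open>x\<close>, ready for Parseval. The
  modulus of the coefficient is independent of \<open>a\<close>, hence so is the mean
  square.\<close>

lemma riemann_pair_increment:
  "riemann_pair k (a + x + h) - riemann_pair k (a + x) =
    (if k = 0 then riemann_pair 0 h else cis (- (2 * pi * real k ^ 2 * a)) * riemann_pair k h)
      * cis (2 * pi * of_int (- (int k ^ 2)) * x)"
proof (cases "k = 0")
  case True then show ?thesis by (simp add: riemann_pair_def add_divide_distrib algebra_simps)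
next
  case False
  define p where "p = (\<lambda>y. cis (- (2 * pi * real k ^ 2 * y)))"
  have p: "p (a + x + h) = p a * p x * p h" "p (a + x) = p a * p x"
    by (auto simp: p_def cis_mult algebra_simps)
  have px: "cis (2 * pi * of_int (- (int k ^ 2)) * x) = p x" by (simp add: p_def)
  have rp: "riemann_pair k y = (1 - p y) / of_real (2 * pi\<^sup>2 * real k ^ 2)" for y
    using False by (simp add: riemann_pair_def p_def)
  have "riemann_pair k (a + x + h) - riemann_pair k (a + x) = p a * riemann_pair k h * p x"
    unfolding rp p by (simp add: diff_divide_distrib algebra_simps)
  then show ?thesis unfolding px using False by (simp add: p_def)
qed

text \<open>A weighted geometric mean of \<open>u\<close> and \<open>v\<close> dominates their
  minimum. It replaces splitting the frequency sum at \<open>k^2 = 1 / h\<close>, at the price of a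
  small loss in the exponent.\<close>

lemma min_le_powr_interpolation:
  fixes u v b \<tau> :: real
  assumes "0 \<le> b" "b \<le> u" "b \<le> v" "0 < \<tau>" "\<tau> < 1"
  shows "b\<^sup>2 \<le> u powr (2 - 2 * \<tau>) * v powr (2 * \<tau>)"
proof -
  have "b\<^sup>2 = b powr (2 - 2 * \<tau>) * b powr (2 * \<tau>)"
    using assms by (cases "b = 0") (auto simp: powr_numeral simp flip: powr_add)
  also have "\<dots> \<le> u powr (2 - 2 * \<tau>) * v powr (2 * \<tau>)"
    using assms by (intro mult_mono powr_mono2) auto
  finally show ?thesis .
qed

text \<open>Interpolating between \<open>h\<close> and \<open>1 / k^2\<close> bounds the coefficient
  squares by \<open>h^(2 - 2 \<tau>) k^(-4 \<tau>)\<close>, summable in \<open>k\<close> precisely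
  because \<open>\<tau> > 1/4\<close>. The constant serves all \<open>a\<close> and
  \<open>h\<close>, as the averaging over the grid requires.\<close>

lemma riemann_phi_increment_L2:
  assumes "1/4 < \<tau>" "\<tau> < 1"
  obtains C where "C \<ge> 0" "\<And>a h. 0 < h \<Longrightarrow> h \<le> 1 \<Longrightarrow>
    (\<integral>\<^sup>+x. ennreal ((dist (riemann_phi ((a + x + h) / (2 * pi))) (riemann_phi ((a + x) / (2 * pi))))\<^sup>2)
        * indicator {0..1} x \<partial>lborel) \<le> ennreal (C * h powr (2 - 2 * \<tau>))"
proof -
  \<comment> \<open>The value at 0 is set to 1, since \<open>0 powr _\<close> would give 0 and could
    not dominate the linear term.\<close>
  define g where "g = (\<lambda>k::nat. if k = 0 then 1 else real k powr (- 4 * \<tau>))"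
  have "summable (\<lambda>k::nat. real k powr (- 4 * \<tau>))" using assms by (simp add: summable_real_powr_iff)
  then have g: "summable g"
    by (rule summable_cong[THEN iffD1, rotated]) (auto simp: g_def eventually_sequentially intro!: exI[of _ 1])
  have g0: "g k \<ge> 0" for k by (simp add: g_def)
  define C where "C = (\<Sum>k. g k)"
  have "C \<ge> 0" unfolding C_def by (intro suminf_nonneg g g0)
  moreover have "(\<integral>\<^sup>+x. ennreal ((dist (riemann_phi ((a + x + h) / (2 * pi))) (riemann_phi ((a + x) / (2 * pi))))\<^sup>2)
        * indicator {0..1} x \<partial>lborel) \<le> ennreal (C * h powr (2 - 2 * \<tau>))"
    if h: "0 < h" "h \<le> 1" for a h
  proof -
    define b where "b = (\<lambda>k. if k = 0 then riemann_pair 0 h else cis (- (2 * pi * real k ^ 2 * a)) * riemann_pair k h)"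
    define F where "F = (\<lambda>N x. \<Sum>k<N. b k * cis (2 * pi * of_int (- (int k ^ 2)) * x))"
    define D where "D = (\<lambda>x. riemann_phi ((a + x + h) / (2 * pi)) - riemann_phi ((a + x) / (2 * pi)))"
    have FD: "(\<lambda>N. F N x) \<longlonglongrightarrow> D x" for x
      using sums_diff[OF riemann_pair_sums[of "a + x + h"] riemann_pair_sums[of "a + x"]]
      unfolding sums_def F_def D_def b_def riemann_pair_increment .
    have bg: "(cmod (b k))\<^sup>2 \<le> h powr (2 - 2 * \<tau>) * g k" for k
    proof (cases "k = 0")
      case True
      have "cmod (b k) = h / (2 * pi)" using True h by (simp add: b_def riemann_pair_def norm_mult norm_divide)
      also have "\<dots> \<le> h" using h pi_gt3 by (simp add: divide_le_eq mult_le_cancel_left1)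
      finally have "cmod (b k) \<le> h" .
      then have "(cmod (b k))\<^sup>2 \<le> h powr (2 - 2 * \<tau>) * 1 powr (2 * \<tau>)"
        using h assms by (intro min_le_powr_interpolation) auto
      then show ?thesis using True by (simp add: g_def)
    next
      case False
      have "(cmod (b k))\<^sup>2 \<le> h powr (2 - 2 * \<tau>) * (1 / real k ^ 2) powr (2 * \<tau>)"
        using h assms False norm_riemann_pair_le[of k h]
        by (intro min_le_powr_interpolation) (auto simp: b_def norm_mult)
      also have "(1 / real k ^ 2) = real k powr (-2)" using False by (simp add: powr_minus powr_numeral inverse_eq_divide)
      finally show ?thesis using False by (simp add: g_def powr_powr)
    qed
    \<comment> \<open>Squares are distinct only on nonnegative indices; this is why \<open>k\<close>
      and \<open>- k\<close> were paired.\<close>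
    have inj: "inj_on (\<lambda>k::nat. - (int k ^ 2)) {..<N}" for N
      by (auto intro!: inj_onI simp: power2_eq_iff_nonneg)
    have int: "(\<integral>\<^sup>+x. ennreal ((cmod (F N x))\<^sup>2) * indicator {0..1} x \<partial>lborel) \<le> ennreal (C * h powr (2 - 2 * \<tau>))" for N
    proof -
      have "(\<integral>\<^sup>+x. ennreal ((cmod (F N x))\<^sup>2) * indicator {0..1} x \<partial>lborel) = ennreal (\<Sum>k<N. (cmod (b k))\<^sup>2)"
        unfolding F_def
        by (rule nn_integral_has_integral_lebesgue'[OF _ trig_sum_parseval[OF _ inj]]) auto
      also have "(\<Sum>k<N. (cmod (b k))\<^sup>2) \<le> (\<Sum>k<N. h powr (2 - 2 * \<tau>) * g k)"
        by (intro sum_mono bg)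
      also have "\<dots> = (\<Sum>k<N. g k) * h powr (2 - 2 * \<tau>)" by (simp add: sum_distrib_right mult.commute)
      also have "\<dots> \<le> C * h powr (2 - 2 * \<tau>)"
        unfolding C_def using g g0 by (intro mult_right_mono sum_le_suminf) auto
      finally show ?thesis by (simp add: ennreal_leI)
    qed
    have "(\<integral>\<^sup>+x. ennreal ((cmod (D x))\<^sup>2) * indicator {0..1} x \<partial>lborel) =
        (\<integral>\<^sup>+x. liminf (\<lambda>N. ennreal ((cmod (F N x))\<^sup>2) * indicator {0..1} x) \<partial>lborel)"
    proof (intro nn_integral_cong)
      fix x :: real
      have "(\<lambda>N. ennreal ((cmod (F N x))\<^sup>2) * indicator {0..1} x) \<longlonglongrightarrow> ennreal ((cmod (D x))\<^sup>2) * indicator {0..1} x"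
      proof (cases "x \<in> {0..1}")
        case True
        then show ?thesis by (simp, intro tendsto_ennrealI tendsto_power tendsto_norm FD)
      qed simp
      from lim_imp_Liminf[OF _ this]
      show "ennreal ((cmod (D x))\<^sup>2) * indicator {0..1} x = liminf (\<lambda>N. ennreal ((cmod (F N x))\<^sup>2) * indicator {0..1} x)" by simp
    qed
    \<comment> \<open>Fatou's lemma: pointwise convergence of the partial sums is enough for an
      upper bound.\<close>
    also have "\<dots> \<le> liminf (\<lambda>N. \<integral>\<^sup>+x. ennreal ((cmod (F N x))\<^sup>2) * indicator {0..1} x \<partial>lborel)"
    proof (rule nn_integral_liminf)
      fix N
      have "continuous_on UNIV (F N)" unfolding F_def by (intro continuous_intros)
      then have [measurable]: "F N \<in> borel_measurable borel" by (rule borel_measurable_continuous_onI)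
      show "(\<lambda>x. ennreal ((cmod (F N x))\<^sup>2) * indicator {0..1} x) \<in> borel_measurable lborel" by simp
    qed
    also have "\<dots> \<le> limsup (\<lambda>N. \<integral>\<^sup>+x. ennreal ((cmod (F N x))\<^sup>2) * indicator {0..1} x \<partial>lborel)"
      by (rule Liminf_le_Limsup) simp
    also have "\<dots> \<le> ennreal (C * h powr (2 - 2 * \<tau>))"
      by (intro Limsup_bounded always_eventually allI int)
    finally show ?thesis by (simp add: D_def dist_norm)
  qed
  ultimately show ?thesis using that by blast
qed

section \<open>Choice of the origin of the dyadic grid\<close>

text \<open>The integral over \<open>\<theta>\<close> of the level \<open>m\<close> energy is at
  most a constant times \<open>2^(\<gamma> m) * 2^m * 2^(-(2 - 2 \<tau>) m) = q^m\<close> with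
  \<open>q < 1\<close>. The series of energies thus has a finite integral, hence is finite at some
  \<open>\<theta>\<close>.\<close>

lemma riemann_phi_dyadic_energy:
  fixes \<gamma> :: real
  assumes \<gamma>: "0 < \<gamma>" "\<gamma> < 1/2"
  obtains \<theta> where "summable (\<lambda>m. 2 powr (\<gamma> * real m) *
    (\<Sum>i<2^m. (midpoint_increment (\<lambda>x. riemann_phi ((\<theta> + x) / (2 * pi))) m i)\<^sup>2))"
proof -
  \<comment> \<open>The midpoint of \<open>1/4\<close> and \<open>(1 - \<gamma>) / 2\<close>:
    convergence in \<open>k\<close> needs \<open>\<tau>\<close> above the first, decay in
    \<open>m\<close> needs it below the second.\<close>
  define \<tau> where "\<tau> = 3/8 - \<gamma>/4"
  have \<tau>: "1/4 < \<tau>" "\<tau> < 1" "\<gamma> < 1 - 2 * \<tau>" using \<gamma> by (auto simp: \<tau>_def)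
  obtain C where C: "C \<ge> 0" "\<And>a h. 0 < h \<Longrightarrow> h \<le> 1 \<Longrightarrow>
    (\<integral>\<^sup>+x. ennreal ((dist (riemann_phi ((a + x + h) / (2 * pi))) (riemann_phi ((a + x) / (2 * pi))))\<^sup>2)
        * indicator {0..1} x \<partial>lborel) \<le> ennreal (C * h powr (2 - 2 * \<tau>))"
    using riemann_phi_increment_L2[OF \<tau>(1,2)] by blast
  define c where "c = (\<lambda>m i \<theta>. midpoint_increment (\<lambda>x. riemann_phi ((\<theta> + x) / (2 * pi))) m i)"
  define E where "E = (\<lambda>m \<theta>. 2 powr (\<gamma> * real m) * (\<Sum>i<2^m. (c m i \<theta>)\<^sup>2))"
  \<comment> \<open>Now \<open>\<theta>\<close> is the integration variable, the dyadic point
    \<open>i / 2^m\<close> acts as \<open>a\<close>, and the step is half an interval.\<close>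
  have c_eq: "c m i \<theta> = dist (riemann_phi ((real i / 2^m + \<theta> + 1 / 2^Suc m) / (2 * pi)))
      (riemann_phi ((real i / 2^m + \<theta>) / (2 * pi)))" for m i \<theta>
  proof -
    have "\<theta> + (2 * real i + 1) / 2^Suc m = real i / 2^m + \<theta> + 1 / 2^Suc m"
      by (simp add: add_divide_distrib)
    then show ?thesis
      unfolding c_def midpoint_increment_def by (simp only: add.commute[of \<theta> "real i / 2^m"])
  qed
  have meas [measurable]: "(\<lambda>x. riemann_phi (x / (2 * pi))) \<in> borel_measurable borel"
    by (intro borel_measurable_continuous_onI continuous_on_riemann_phi)
  have meas' [measurable]: "(\<lambda>\<theta>. riemann_phi ((y + \<theta> + z) / (2 * pi))) \<in> borel_measurable borel"
    "(\<lambda>\<theta>. riemann_phi ((y + \<theta>) / (2 * pi))) \<in> borel_measurable borel" for y z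
    using measurable_compose[OF _ meas, of "\<lambda>\<theta>. y + \<theta> + z" borel]
      measurable_compose[OF _ meas, of "\<lambda>\<theta>. y + \<theta>" borel] by simp_all
  have c_meas [measurable]: "c m i \<in> borel_measurable borel" for m i
    unfolding c_eq[abs_def] by measurable
  have E_meas [measurable]: "E m \<in> borel_measurable borel" for m
    unfolding E_def by measurable
  define q where "q = 2 powr (\<gamma> - (1 - 2 * \<tau>))"
  have q: "0 < q" "q < 1" using \<tau> by (auto simp: q_def powr_less_one)
  have E_int: "(\<integral>\<^sup>+\<theta>. ennreal (E m \<theta>) * indicator {0..1} \<theta> \<partial>lborel) \<le> ennreal (C * q ^ m)" for m
  proof -
    have "(\<integral>\<^sup>+\<theta>. ennreal (E m \<theta>) * indicator {0..1} \<theta> \<partial>lborel) =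
       (\<integral>\<^sup>+\<theta>. ennreal (2 powr (\<gamma> * real m)) * (\<Sum>i<2^m. ennreal ((c m i \<theta>)\<^sup>2) * indicator {0..1} \<theta>) \<partial>lborel)"
      by (intro nn_integral_cong) (simp add: E_def ennreal_mult' sum_distrib_right[symmetric] mult.assoc)
    also have "\<dots> = ennreal (2 powr (\<gamma> * real m)) *
        (\<Sum>i<2^m. \<integral>\<^sup>+\<theta>. ennreal ((c m i \<theta>)\<^sup>2) * indicator {0..1} \<theta> \<partial>lborel)"
      by (subst nn_integral_cmult, simp, subst nn_integral_sum) simp_all
    also have "\<dots> \<le> ennreal (2 powr (\<gamma> * real m)) * (\<Sum>i<(2::nat)^m. ennreal (C * (1 / 2^Suc m) powr (2 - 2 * \<tau>)))"
      unfolding c_eq using one_le_power[of "2::real" "Suc m"]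
      by (intro mult_left_mono sum_mono C(2)) (auto simp del: power_Suc)
    also have "\<dots> = ennreal (2 powr (\<gamma> * real m) * (2^m * (C * (1 / 2^Suc m) powr (2 - 2 * \<tau>))))"
      using C(1) by (simp add: ennreal_mult' ennreal_power[symmetric])
    also have "\<dots> \<le> ennreal (C * q ^ m)"
    proof (intro ennreal_leI)
      have "2 powr (\<gamma> * real m) * (2^m * (C * (1 / 2^Suc m) powr (2 - 2 * \<tau>))) \<le>
          2 powr (\<gamma> * real m) * (2^m * (C * (1 / 2^m) powr (2 - 2 * \<tau>)))"
        using C(1) \<tau> by (intro mult_left_mono powr_mono2) (auto simp: field_simps)
      also have "1 / 2^m = 2 powr (- real m)" by (simp add: powr_minus powr_realpow inverse_eq_divide)
      also have "(2::real)^m = 2 powr real m" by (simp add: powr_realpow)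
      also have "2 powr (\<gamma> * real m) * (2 powr real m * (C * (2 powr - real m) powr (2 - 2 * \<tau>))) =
          C * (2 powr (\<gamma> * real m) * (2 powr real m * 2 powr (- real m * (2 - 2 * \<tau>))))"
        by (simp add: powr_powr mult_ac)
      also have "2 powr (\<gamma> * real m) * (2 powr real m * 2 powr (- real m * (2 - 2 * \<tau>))) = q powr real m"
        unfolding q_def powr_powr powr_add[symmetric]
        by (rule arg_cong[where f = "(powr) 2"]) (simp add: algebra_simps)
      also have "\<dots> = q ^ m" using q by (simp add: powr_realpow)
      finally show "2 powr (\<gamma> * real m) * (2^m * (C * (1 / 2^Suc m) powr (2 - 2 * \<tau>))) \<le> C * q ^ m"
        by (simp only: powr_realpow zero_less_numeral)
    qed
    finally show ?thesis .
  qed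
  have "(\<integral>\<^sup>+\<theta>. (\<Sum>m. ennreal (E m \<theta>) * indicator {0..1} \<theta>) \<partial>lborel) =
      (\<Sum>m. \<integral>\<^sup>+\<theta>. ennreal (E m \<theta>) * indicator {0..1} \<theta> \<partial>lborel)"
    by (intro nn_integral_suminf) simp
  also have "\<dots> \<le> (\<Sum>m. ennreal (C * q ^ m))" by (intro suminf_le E_int) auto
  also have "\<dots> = ennreal (C * (1 / (1 - q)))"
    using C(1) q sums_mult[OF geometric_sums[of q], of C] by (intro suminf_ennreal_eq) auto
  finally have fin: "(\<integral>\<^sup>+\<theta>. (\<Sum>m. ennreal (E m \<theta>) * indicator {0..1} \<theta>) \<partial>lborel) < top"
    using le_less_trans ennreal_less_top by blast
  \<comment> \<open>Divergence at every \<open>\<theta>\<close> in the unit interval would make the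
    integral infinite.\<close>
  have "\<exists>\<theta>\<in>{0..1}. (\<Sum>m. ennreal (E m \<theta>)) \<noteq> top"
  proof (rule ccontr)
    assume "\<not> ?thesis"
    then have "(\<integral>\<^sup>+\<theta>. (\<Sum>m. ennreal (E m \<theta>) * indicator {0..1} \<theta>) \<partial>lborel) =
        (\<integral>\<^sup>+\<theta>. top * indicator {0..1::real} \<theta> \<partial>lborel)"
      by (intro nn_integral_cong) (auto simp: indicator_def)
    also have "\<dots> = top" by (subst nn_integral_cmult_indicator) (auto simp: ennreal_top_mult)
    finally show False using fin by simp
  qed
  then obtain \<theta> where "(\<Sum>m. ennreal (E m \<theta>)) \<noteq> top" by blast
  then have "summable (\<lambda>m. E m \<theta>)"
    by (intro summable_suminf_not_top) (auto simp: E_def intro!: mult_nonneg_nonneg sum_nonneg)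
  then show ?thesis using that[of \<theta>] by (simp add: E_def c_def)
qed

section \<open>Dimension of the image\<close>

text \<open>The image is a countable union of pieces over the unit intervals starting at
  \<open>\<theta> + n\<close>. These pieces are translates, so one \<open>\<theta>\<close> with
  finite energy serves them all.\<close>

lemma hausdorff_measure_range_riemann_phi_eq_0:
  assumes "4/3 < s" "s < 2"
  shows "hausdorff_measure s (range riemann_phi) = 0"
proof -
  \<comment> \<open>The midpoint of \<open>2 / s - 1\<close> and \<open>1/2\<close>; the gap is open
    because \<open>s > 4/3\<close>, and \<open>s < 2\<close> keeps \<open>\<gamma>\<close>
    positive.\<close>
  define \<gamma> where "\<gamma> = (2 / s - 1 + 1/2) / 2"
  have "2 / s - 1 < 1/2" "0 < 2 / s - 1" using assms by (auto simp: field_simps)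
  then have \<gamma>: "0 < \<gamma>" "\<gamma> < 1/2" "2 / s - 1 < \<gamma>" by (auto simp: \<gamma>_def)
  then have s\<gamma>: "2 < s * (1 + \<gamma>)" using assms by (simp add: field_simps)
  obtain \<theta> where \<theta>: "summable (\<lambda>m. 2 powr (\<gamma> * real m) *
    (\<Sum>i<2^m. (midpoint_increment (\<lambda>x. riemann_phi ((\<theta> + x) / (2 * pi))) m i)\<^sup>2))"
    using riemann_phi_dyadic_energy[OF \<gamma>(1,2)] by blast
  define f where "f = (\<lambda>n x. riemann_phi ((\<theta> + x + of_int n) / (2 * pi)))"
  have inc: "midpoint_increment (f n) m i =
      midpoint_increment (\<lambda>x. riemann_phi ((\<theta> + x) / (2 * pi))) m i" for n m i
    by (simp add: midpoint_increment_def f_def riemann_phi_plus_int)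
  have cont: "isCont (f n) x" for n x
    unfolding f_def
    by (rule isCont_o2[where g = "\<lambda>x. riemann_phi (x / (2 * pi))"])
       (use continuous_on_riemann_phi in \<open>auto simp: continuous_on_eq_continuous_at\<close>)
  have "hausdorff_measure s (f (int_decode k) ` {0..<1}) = 0" for k
    using assms \<theta> s\<gamma> \<gamma> cont
    by (intro hausdorff_measure_eq_0_of_dyadic_energy[where \<gamma> = \<gamma>]) (auto simp: inc)
  then have "hausdorff_measure s (\<Union>k. f (int_decode k) ` {0..<1}) = 0"
    by (rule hausdorff_measure_UN_eq_0)
  moreover have "(\<Union>k. f (int_decode k) ` {0..<1}) = range riemann_phi"
  proof (intro equalityI subsetI)
    fix z assume "z \<in> range riemann_phi"
    then obtain t where t: "z = riemann_phi t" by blast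
    define y where "y = 2 * pi * t - \<theta>"
    have "z = f \<lfloor>y\<rfloor> (frac y)" unfolding t f_def y_def by (simp add: frac_def)
    then have "z = f (int_decode (int_encode \<lfloor>y\<rfloor>)) (frac y)" by simp
    then show "z \<in> (\<Union>k. f (int_decode k) ` {0..<1})" using frac_lt_1 frac_ge_0 by fastforce
  qed (auto simp: f_def)
  ultimately show ?thesis by simp
qed

theorem theorem1:
  shows "1 \<le> hausdorff_dim (range riemann_phi) \<and> hausdorff_dim (range riemann_phi) \<le> ereal (4/3)"
proof
  have 0: "riemann_phi 0 = 0" by (simp add: riemann_phi_def riemann_term_def cong: if_cong)
  have 1: "riemann_phi (1 / (2 * pi)) = \<i> * of_real (1 / (2 * pi))"
    using riemann_phi_plus_int[of 0 1] by (simp add: 0)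
  have "{0..1 / (2 * pi)} \<subseteq> Im ` range riemann_phi"
  proof
    fix y :: real assume y: "y \<in> {0..1 / (2 * pi)}"
    have "\<exists>x\<ge>0. x \<le> 1 \<and> Im (riemann_phi (x / (2 * pi))) = y"
    proof (rule IVT')
      show "continuous_on {0..1} (\<lambda>x. Im (riemann_phi (x / (2 * pi))))"
        using continuous_on_riemann_phi by (intro continuous_on_Im) (rule continuous_on_subset, auto)
    qed (use y 0 1 in auto)
    then show "y \<in> Im ` range riemann_phi" by blast
  qed
  then have pos: "hausdorff_measure s (range riemann_phi) \<noteq> 0" if "s < 1" for s
    using that by (intro hausdorff_measure_pos_of_Im_image[where L = "1 / (2 * pi)"]) auto
  show "1 \<le> hausdorff_dim (range riemann_phi)"
    unfolding hausdorff_dim_def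
  proof (rule Inf_greatest)
    fix x assume "x \<in> {ereal s |s. 0 \<le> s \<and> hausdorff_measure s (range riemann_phi) = 0}"
    then show "1 \<le> x" using pos by (force simp: one_ereal_def not_less)
  qed
  show "hausdorff_dim (range riemann_phi) \<le> ereal (4/3)"
  proof (rule ereal_le_epsilon2)
    fix e :: real assume e: "0 < e"
    \<comment> \<open>The cap \<open>1/3\<close> keeps \<open>s\<close> below 2, where the null set
      result applies.\<close>
    define s where "s = 4/3 + min e (1/3)"
    have s: "4/3 < s" "s < 2" "s \<le> 4/3 + e" using e by (auto simp: s_def)
    have "hausdorff_dim (range riemann_phi) \<le> ereal s"
      unfolding hausdorff_dim_def
      using s hausdorff_measure_range_riemann_phi_eq_0[OF s(1,2)] by (intro Inf_lower) auto
    also have "\<dots> \<le> ereal (4/3) + ereal e" using s by simp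
    finally show "hausdorff_dim (range riemann_phi) \<le> ereal (4/3) + ereal e" .
  qed
qed

end
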